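(* Let $\hat M_n$ be an estimator of the adjacency matrix $M\in\mathbb R^{p\times p}$ such that $\sqrt g\operatorname{vec}(\hat M_n-M)$ converges in distribution to $N(0,\Omega)$. (1) The PageRank and Katz centralities $c_P$ and $c_K$ are smooth functions of $M$. Furthermore, $\hat M_n\to M$ in probability implies $\hat c_{P,i}\to c_{P,i}$ in probability, and $$\sqrt g\,\frac{\hat c_{P,i}-c_{P,i}}{\sigma_{P,i}}\ \text{ converges in distribution to }N(0,1),\qquad\sigma_{P,i}^2=B_{P,i}\Omega B_{P,i}^{\mathsf T},$$ where $B_{P,i}=\left(-\alpha\beta^{\mathsf T}(I-\alpha M^{\mathsf T})^{-1}\right)\otimes\left(e_i^{\mathsf T}(I-\alpha M)^{-1}\right)$. Setting $\beta=\mathbf 1$ in $\sigma_{P,i}$ gives the same result for the Katz centrality. (2) The diffusion centrality $c_D$ is a smooth function of $M$. Furthermore, $\hat M_n\to M$ in probability implies $\hat c_{D,i}\to c_{D,i}$ in probability, and $$\sqrt g\,\frac{\hat c_{D,i}-c_{D,i}}{\sigma_{D,i}}\ \text{ converges in distribution to }N(0,1),\qquad\sigma_{D,i}^2=B_{D,i}\Omega B_{D,i}^{\mathsf T},$$ where $B_{D,i}=\sum_{s=0}^S\alpha^{s}\sum_{j=1}^s\left(\mathbf 1^{\mathsf T}(M^{\mathsf T})^{s-j}\right)\otimes\left(e_i^{\mathsf T}M^{j-1}\right)$.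
   Context: $\alpha\in\mathbb R$ (damping factor, between $0$ and $1/\lambda_{\max}(M)$, so that $I-\alpha M$ is invertible), $\beta\in\mathbb R^p$ and $S\in\mathbb N$ are constants; $\mathbf 1\in\mathbb R^p$ is the vector of ones; $e_i$ is the $i$th standard basis vector of $\mathbb R^p$. The centralities are: PageRank $c_P=(I-\alpha M)^{-1}\beta$; Katz $c_K=(I-\alpha M)^{-1}\mathbf 1$; diffusion $c_D=\left(\sum_{s=0}^S\alpha^sM^s\right)\mathbf 1$. Subscript $i$ denotes the $i$th coordinate; hats denote evaluation at $\hat M_n$. $\Omega\in\mathbb R^{p^2\times p^2}$ is positive definite and the asymptotic variances $\sigma_{P,i}^2,\sigma_{D,i}^2$ are nonzero. $g\in\{n,T\}$ denotes the sample size. *)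

theory Defs
  imports "HOL-Probability.Probability"
begin

section \<open>Matrices\<close>

text \<open>The operation \<open>^\<close> on \<open>real ^ 'n ^ 'n\<close> is the componentwise power, hence a separate
  definition for the power with respect to the matrix product.\<close>

primrec matpow :: "real ^ 'n ^ 'n \<Rightarrow> nat \<Rightarrow> real ^ 'n ^ 'n" where
  "matpow A 0 = mat 1"
| "matpow A (Suc k) = A ** matpow A k"

text \<open>Column stacking. The position \<open>(j, i)\<close> of the stacked vector is entry \<open>i\<close> of
  column \<open>j\<close>; the lexicographic order of these pairs is the usual order of the stacked vector.\<close>

definition vectorize :: "real ^ 'n ^ 'm \<Rightarrow> real ^ ('n \<times> 'm)" where
  "vectorize A = (\<chi> k. A $ snd k $ fst k)"

text \<open>Kronecker product of two row vectors. Row vectors are represented as vectors, which act on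
  matrices from the left by \<open>v*\<close>.\<close>

definition kron :: "real ^ 'n \<Rightarrow> real ^ 'm \<Rightarrow> real ^ ('n \<times> 'm)" where
  "kron u v = (\<chi> k. u $ fst k * v $ snd k)"

definition positive_definite :: "real ^ 'n ^ 'n \<Rightarrow> bool" where
  "positive_definite A \<longleftrightarrow> transpose A = A \<and> (\<forall>x. x \<noteq> 0 \<longrightarrow> 0 < x \<bullet> (A *v x))"

definition real_eigenvalues :: "real ^ 'n ^ 'n \<Rightarrow> real set" where
  "real_eigenvalues A = {l. \<exists>v. v \<noteq> 0 \<and> A *v v = l *\<^sub>R v}"

text \<open>The supremum is a maximum unless there is no real eigenvalue, in which case it is
  \<open>-\<infinity>\<close>.\<close>

definition lambda_max :: "real ^ 'n ^ 'n \<Rightarrow> ereal" where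
  "lambda_max A = Sup (ereal ` real_eigenvalues A)"

section \<open>Smooth functions\<close>

text \<open>\<open>C_k_on k f S\<close> for open \<open>S\<close>: \<open>f\<close> is \<open>k\<close> times continuously differentiable on \<open>S\<close>. As the
  domain has finite dimension, the derivative is of class \<open>C\<^sup>k\<close> iff all its values at
  fixed directions \<open>v\<close> are.\<close>

primrec C_k_on :: "nat \<Rightarrow> ('a::euclidean_space \<Rightarrow> 'b::real_normed_vector) \<Rightarrow> 'a set \<Rightarrow> bool" where
  "C_k_on 0 f S \<longleftrightarrow> continuous_on S f"
| "C_k_on (Suc k) f S \<longleftrightarrow> (\<forall>x\<in>S. f differentiable (at x)) \<and>
     (\<forall>v. C_k_on k (\<lambda>x. frechet_derivative f (at x) v) S)"

definition smooth_on :: "('a::euclidean_space \<Rightarrow> 'b::real_normed_vector) \<Rightarrow> 'a set \<Rightarrow> bool" where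
  "smooth_on f S \<longleftrightarrow> open S \<and> (\<forall>k. C_k_on k f S)"

section \<open>Convergence of random variables\<close>

text \<open>The \<open>n\<close>-th random variable lives on its own probability space \<open>P n\<close>.\<close>

definition converges_in_prob ::
    "(nat \<Rightarrow> 'w measure) \<Rightarrow> (nat \<Rightarrow> 'w \<Rightarrow> 'b::metric_space) \<Rightarrow> 'b \<Rightarrow> bool" where
  "converges_in_prob P X c \<longleftrightarrow>
     (\<forall>\<epsilon>>0. (\<lambda>n. measure (P n) {\<omega> \<in> space (P n). dist (X n \<omega>) c > \<epsilon>}) \<longlonglongrightarrow> 0)"

definition converges_in_distr ::
    "(nat \<Rightarrow> 'w measure) \<Rightarrow> (nat \<Rightarrow> 'w \<Rightarrow> 'b::topological_space) \<Rightarrow> 'b measure \<Rightarrow> bool" where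
  "converges_in_distr P X N \<longleftrightarrow>
     (\<forall>f :: 'b \<Rightarrow> real. continuous_on UNIV f \<and> bounded (range f) \<longrightarrow>
        (\<lambda>n. \<integral>\<omega>. f (X n \<omega>) \<partial>P n) \<longlonglongrightarrow> (\<integral>x. f x \<partial>N))"

text \<open>For real random variables this is the weak convergence of the library.\<close>

lemma converges_in_distr_iff_weak_conv_m:
  fixes X :: "nat \<Rightarrow> 'w \<Rightarrow> real"
  assumes P: "\<And>n. prob_space (P n)" and X[measurable]: "\<And>n. X n \<in> borel_measurable (P n)"
    and N: "real_distribution N"
  shows "converges_in_distr P X N \<longleftrightarrow> weak_conv_m (\<lambda>n. distr (P n) borel (X n)) N"
proof -
  have d: "real_distribution (distr (P n) borel (X n))" for n
    using P X by (intro prob_space.real_distribution_distr) auto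
  have eq: "(\<integral>\<omega>. f (X n \<omega>) \<partial>P n) = (\<integral>x. f x \<partial>distr (P n) borel (X n))"
    if "continuous_on UNIV f" for f :: "real \<Rightarrow> real" and n
    using that by (subst integral_distr) (auto intro: borel_measurable_continuous_onI)
  show ?thesis
  proof
    assume c: "converges_in_distr P X N"
    show "weak_conv_m (\<lambda>n. distr (P n) borel (X n)) N"
    proof (rule integral_bdd_continuous_conv_imp_weak_conv[OF d N])
      fix f :: "real \<Rightarrow> real" assume f: "\<And>x. isCont f x" "\<And>x. \<bar>f x\<bar> \<le> 1"
      then have "continuous_on UNIV f" "bounded (range f)"
        by (auto intro: continuous_at_imp_continuous_on simp: bounded_iff)
      with c show "(\<lambda>n. \<integral>x. f x \<partial>distr (P n) borel (X n)) \<longlonglongrightarrow> (\<integral>x. f x \<partial>N)"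
        by (auto simp: converges_in_distr_def eq)
    qed
  next
    assume w: "weak_conv_m (\<lambda>n. distr (P n) borel (X n)) N"
    show "converges_in_distr P X N"
      unfolding converges_in_distr_def
    proof (intro allI impI, elim conjE)
      fix f :: "real \<Rightarrow> real" assume f: "continuous_on UNIV f" "bounded (range f)"
      then obtain B where B: "\<And>x. norm (f x) \<le> B" by (auto simp: bounded_iff)
      have "isCont f x" for x using f by (simp add: continuous_on_eq_continuous_at)
      from weak_conv_imp_integral_bdd_continuous_conv[OF d N w this B]
      show "(\<lambda>n. \<integral>\<omega>. f (X n \<omega>) \<partial>P n) \<longlonglongrightarrow> (\<integral>x. f x \<partial>N)"
        by (simp add: eq f)
    qed
  qed
qed

text \<open>The centred normal distribution with positive definite covariance matrix \<open>A\<close>.\<close>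

definition multi_normal :: "real ^ 'n ^ 'n \<Rightarrow> (real ^ 'n) measure" where
  "multi_normal A = density lborel
     (\<lambda>x. ennreal (exp (- (x \<bullet> (matrix_inv A *v x)) / 2) / sqrt ((2 * pi) ^ CARD('n) * det A)))"

section \<open>Centralities and their asymptotic variances\<close>

definition pagerank :: "real \<Rightarrow> real ^ 'n \<Rightarrow> real ^ 'n ^ 'n \<Rightarrow> real ^ 'n" where
  "pagerank \<alpha> \<beta> A = matrix_inv (mat 1 - \<alpha> *\<^sub>R A) *v \<beta>"

definition katz :: "real \<Rightarrow> real ^ 'n ^ 'n \<Rightarrow> real ^ 'n" where
  "katz \<alpha> A = matrix_inv (mat 1 - \<alpha> *\<^sub>R A) *v 1"

definition diffusion :: "real \<Rightarrow> nat \<Rightarrow> real ^ 'n ^ 'n \<Rightarrow> real ^ 'n" where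
  "diffusion \<alpha> S A = (\<Sum>s = 0..S. \<alpha> ^ s *\<^sub>R matpow A s) *v 1"

text \<open>The vector \<open>axis i 1\<close> is the \<open>i\<close>-th standard basis vector.\<close>

definition B_pagerank :: "real \<Rightarrow> real ^ 'n \<Rightarrow> real ^ 'n ^ 'n \<Rightarrow> 'n \<Rightarrow> real ^ ('n \<times> 'n)" where
  "B_pagerank \<alpha> \<beta> A i =
     kron ((- \<alpha>) *\<^sub>R (\<beta> v* matrix_inv (mat 1 - \<alpha> *\<^sub>R transpose A)))
          (axis i 1 v* matrix_inv (mat 1 - \<alpha> *\<^sub>R A))"

definition B_diffusion :: "real \<Rightarrow> nat \<Rightarrow> real ^ 'n ^ 'n \<Rightarrow> 'n \<Rightarrow> real ^ ('n \<times> 'n)" where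
  "B_diffusion \<alpha> S A i =
     (\<Sum>s = 0..S. \<alpha> ^ s *\<^sub>R
        (\<Sum>j = 1..s. kron (1 v* matpow (transpose A) (s - j)) (axis i 1 v* matpow A (j - 1))))"

text \<open>The scalar \<open>B \<Omega> B\<^sup>T\<close> for a row vector \<open>B\<close>.\<close>

definition asymp_var :: "real ^ 'k ^ 'k \<Rightarrow> real ^ 'k \<Rightarrow> real" where
  "asymp_var \<Omega> B = (B v* \<Omega>) \<bullet> B"

end

theory Submission
  imports Defs "HOL-Complex_Analysis.Conformal_Mappings"
begin

text \<open>
  All three centralities are read off from matrix expressions in \<open>M\<close> that are built from \<open>M\<close> by sums,
  products and inverses. The class of such expressions is closed under directional derivatives
  (\<open>matrix_rational_derivative\<close>), which yields smoothness; the resolvent \<open>(I - \<alpha> M)\<^sup>-\<^sup>1\<close> exists because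
  a kernel vector of \<open>I - \<alpha> M\<close> would belong to the eigenvalue \<open>1 / \<alpha>\<close> of \<open>M\<close>, which the bound on the
  damping factor excludes.

  The first derivatives are explicit: \<open>\<alpha> R H R \<beta>\<close> for the resolvent \<open>R\<close>, and
  \<open>\<Sum>\<^sub>s \<alpha>\<^sup>s \<Sum>\<^sub>j M\<^sup>j\<^sup>-\<^sup>1 H M\<^sup>s\<^sup>-\<^sup>j \<one>\<close> for diffusion. Written as row vectors acting on the stacked
  perturbation they are the Kronecker rows \<open>B\<close> (up to sign for PageRank), since
  \<open>(u \<otimes> v) vec H = v H u\<^sup>T\<close>.

  Consistency is the continuous mapping theorem. Asymptotic normality is the delta method
  (\<open>delta_method\<close>): the scaled error of a coordinate is a linear functional of the scaled error of the
  estimator up to a remainder that is negligible by tightness, so its characteristic function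
  converges to that of the derivative applied to a normal vector. That this linear functional is normal with
  variance \<open>B \<Omega> B\<^sup>T\<close>, which is even in \<open>B\<close>, follows from its moment generating function: tilting the Gaussian density by an
  exponential only translates it (\<open>multi_normal_mgf\<close>), and the standard normal law is the only one with
  its moment generating function (\<open>mgf_std_normal_unique\<close>, by analytic continuation to the imaginary
  axis).
\<close>

section \<open>The matrix inverse: continuity, measurability, derivative\<close>

lemma bounded_bilinear_matrix_mult:
  "bounded_bilinear ((**) :: real ^ 'n ^ 'm \<Rightarrow> real ^ 'k ^ 'n \<Rightarrow> real ^ 'k ^ 'm)"
  unfolding bilinear_conv_bounded_bilinear[symmetric] bilinear_def
  by (auto intro!: linearI simp: matrix_matrix_mult_def vec_eq_iff algebra_simps sum.distrib
      sum_distrib_left)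

lemma
  fixes A :: "real ^ 'n ^ 'n"
  assumes "invertible A"
  shows matrix_inv_right: "A ** matrix_inv A = mat 1"
    and matrix_inv_left: "matrix_inv A ** A = mat 1"
  using someI_ex[of "\<lambda>B. A ** B = mat 1 \<and> B ** A = mat 1"] assms
  by (auto simp: matrix_inv_def invertible_def)

lemma matrix_inv_eqI:
  fixes A :: "real ^ 'n ^ 'n"
  assumes "A ** B = mat 1"
  shows "matrix_inv A = B"
proof -
  have "B ** A = mat 1"
    using assms by (simp add: matrix_left_right_inverse)
  with assms have "invertible A"
    by (auto simp: invertible_def)
  then have "matrix_inv A ** (A ** B) = B"
    by (simp add: matrix_mul_assoc matrix_inv_left)
  with assms show ?thesis
    by simp
qed

lemma matrix_inv_transpose:
  fixes A :: "real ^ 'n ^ 'n"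
  assumes "invertible A"
  shows "matrix_inv (transpose A) = transpose (matrix_inv A)"
  by (rule matrix_inv_eqI) (metis assms matrix_inv_left matrix_transpose_mul transpose_mat)

text \<open>Cramer's rule writes every entry of the inverse as a quotient of polynomials in the entries of
  the matrix; continuity and measurability of the inverse are read off from it.\<close>

lemma matrix_inv_cramer:
  fixes A :: "real ^ 'n ^ 'n"
  assumes "det A \<noteq> 0"
  shows "matrix_inv A $ i $ j =
    det (\<chi> k l. if l = i then if k = j then 1 else 0 else A $ k $ l) / det A"
proof -
  let ?x = "matrix_inv A *v axis j 1"
  have "A *v ?x = axis j 1"
    using assms by (simp add: matrix_vector_mul_assoc matrix_inv_right invertible_det_nz)
  then have "?x = (\<chi> k. det (\<chi> i' j'. if j' = k then axis j 1 $ i' else A $ i' $ j') / det A)"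
    using cramer[OF assms] by blast
  then have "?x $ i = det (\<chi> i' j'. if j' = i then axis j 1 $ i' else A $ i' $ j') / det A"
    by simp
  moreover have "?x $ i = matrix_inv A $ i $ j"
    by (simp add: matrix_vector_mult_basis column_def)
  moreover have "axis j (1::real) $ k = (if k = j then 1 else 0)" for k
    by (simp add: axis_def)
  ultimately show ?thesis
    by (simp cong: if_cong)
qed

lemma continuous_on_det [continuous_intros]:
  fixes f :: "'a::topological_space \<Rightarrow> real ^ 'n ^ 'n"
  assumes "continuous_on S f"
  shows "continuous_on S (\<lambda>x. det (f x))"
  unfolding det_def by (intro continuous_intros assms)

lemma open_invertible: "open {A :: real ^ 'n ^ 'n. invertible A}"
  unfolding invertible_det_nz by (intro open_Collect_neq continuous_intros)

lemma continuous_on_cramer_numerator: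
  fixes i j :: "'n::finite"
  shows "continuous_on S (\<lambda>A :: real ^ 'n ^ 'n.
    det (\<chi> k l. if l = i then if k = j then 1 else 0 else A $ k $ l))"
proof (intro continuous_intros)
  fix k l
  show "continuous_on S (\<lambda>A :: real ^ 'n ^ 'n.
    if l = i then if k = j then 1 else 0 else A $ k $ l)"
    by (cases "l = i") (auto intro!: continuous_intros)
qed

lemma continuous_on_matrix_inv:
  "continuous_on {A :: real ^ 'n ^ 'n. invertible A} matrix_inv"
proof -
  have "continuous_on {A :: real ^ 'n ^ 'n. invertible A} (\<lambda>A. \<chi> i j.
      det (\<chi> k l. if l = i then if k = j then 1 else 0 else A $ k $ l) / det A)"
    by (intro continuous_intros continuous_on_cramer_numerator) (auto simp: invertible_det_nz)
  then show ?thesis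
    by (rule continuous_on_eq) (auto simp: vec_eq_iff matrix_inv_cramer invertible_det_nz)
qed

lemma borel_measurable_matrixI:
  fixes f :: "'a \<Rightarrow> real ^ 'n ^ 'm"
  assumes "\<And>i j. (\<lambda>x. f x $ i $ j) \<in> borel_measurable N"
  shows "f \<in> borel_measurable N"
  using assms by (subst borel_measurable_euclidean_space) (auto simp: Basis_vec_def inner_axis)

text \<open>On singular matrices \<open>matrix_inv\<close> chooses from the empty set, always the same junk
  matrix. Hence it is Borel measurable on the whole space, and an estimator plugged into a resolvent
  is a random variable even where the resolvent does not exist.\<close>

lemma borel_measurable_matrix_inv [measurable]:
  "matrix_inv \<in> borel_measurable (borel :: (real ^ 'n ^ 'n) measure)"
proof (rule borel_measurable_matrixI)
  fix i j
  define c where "c = (SOME B :: real ^ 'n ^ 'n. False) $ i $ j"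
  have [measurable]: "det \<in> borel_measurable (borel :: (real ^ 'n ^ 'n) measure)"
    by (intro borel_measurable_continuous_onI continuous_intros)
  have [measurable]: "(\<lambda>A :: real ^ 'n ^ 'n.
      det (\<chi> k l. if l = i then if k = j then 1 else 0 else A $ k $ l)) \<in> borel_measurable borel"
    by (intro borel_measurable_continuous_onI continuous_on_cramer_numerator)
  have "matrix_inv A $ i $ j = (if det A = 0 then c else
      det (\<chi> k l. if l = i then if k = j then 1 else 0 else A $ k $ l) / det A)"
    for A :: "real ^ 'n ^ 'n"
  proof (cases "det A = 0")
    case True
    then have "(\<lambda>B. A ** B = mat 1 \<and> B ** A = mat 1) = (\<lambda>B :: real ^ 'n ^ 'n. False)"
      by (metis invertible_def invertible_det_nz)
    with True show ?thesis
      by (simp add: matrix_inv_def c_def)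
  qed (simp add: matrix_inv_cramer)
  then show "(\<lambda>A :: real ^ 'n ^ 'n. matrix_inv A $ i $ j) \<in> borel_measurable borel"
    by simp
qed

text \<open>From \<open>B\<^sup>-\<^sup>1 - A\<^sup>-\<^sup>1 = - B\<^sup>-\<^sup>1 (B - A) A\<^sup>-\<^sup>1\<close>: replacing the left factor \<open>B\<^sup>-\<^sup>1\<close> by
  \<open>A\<^sup>-\<^sup>1\<close> costs \<open>o(\<parallel>B - A\<parallel>)\<close>, because inversion is continuous.\<close>

lemma has_derivative_matrix_inv:
  fixes A :: "real ^ 'n ^ 'n"
  assumes A: "invertible A"
  shows "(matrix_inv has_derivative (\<lambda>H. - (matrix_inv A ** H ** matrix_inv A))) (at A)"
proof -
  interpret mult: bounded_bilinear "(**) :: real ^ 'n ^ 'n \<Rightarrow> real ^ 'n ^ 'n \<Rightarrow> real ^ 'n ^ 'n"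
    by (rule bounded_bilinear_matrix_mult)
  obtain K where K: "K > 0"
    "\<And>(X :: real ^ 'n ^ 'n) (Y :: real ^ 'n ^ 'n). norm (X ** Y) \<le> norm X * norm Y * K"
    using mult.pos_bounded by blast
  obtain e where e: "e > 0" "\<And>B. dist B A < e \<Longrightarrow> invertible B"
    using open_invertible A unfolding open_dist by blast
  have cont: "matrix_inv \<midarrow>A\<rightarrow> matrix_inv A"
    using continuous_on_matrix_inv A open_invertible
    by (metis continuous_on_eq_continuous_at isContD mem_Collect_eq)
  show ?thesis
  proof (rule has_derivativeI_sandwich[OF \<open>e > 0\<close>])
    show "bounded_linear (\<lambda>H. - (matrix_inv A ** H ** matrix_inv A))"
      by (intro bounded_linear_minus bounded_linear_compose[OF mult.bounded_linear_left]
          mult.bounded_linear_right)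
    show "((\<lambda>B. norm (matrix_inv A - matrix_inv B) * K * norm (matrix_inv A) * K) \<longlongrightarrow> 0) (at A)"
      by (rule tendsto_eq_intros cont refl | simp)+
    fix B assume B: "B \<noteq> A" "dist B A < e"
    have inv: "invertible B"
      using e B by auto
    let ?H = "B - A"
    have "matrix_inv B - matrix_inv A = - (matrix_inv B ** ?H ** matrix_inv A)"
      by (simp add: mult.diff_left mult.diff_right matrix_inv_left[OF inv] matrix_inv_right[OF A]
          flip: matrix_mul_assoc)
    then have "matrix_inv B - matrix_inv A - - (matrix_inv A ** ?H ** matrix_inv A)
        = (matrix_inv A - matrix_inv B) ** ?H ** matrix_inv A"
      by (simp add: mult.diff_left)
    also have "norm \<dots> \<le> norm (matrix_inv A - matrix_inv B) * norm ?H * K * norm (matrix_inv A) * K"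
      using K by (meson K(2) mult_right_mono norm_ge_zero order_trans less_imp_le)
    finally show "norm (matrix_inv B - matrix_inv A - - (matrix_inv A ** ?H ** matrix_inv A)) / norm ?H
        \<le> norm (matrix_inv A - matrix_inv B) * K * norm (matrix_inv A) * K"
      using B by (simp add: divide_simps mult_ac)
  qed
qed

section \<open>Smooth functions from classes closed under differentiation\<close>

text \<open>As \<open>S\<close> is open, the values in \<open>S\<close> determine the derivatives at the points of \<open>S\<close>.\<close>

lemma C_k_on_cong:
  assumes "open S" "\<And>x. x \<in> S \<Longrightarrow> f x = g x"
  shows "C_k_on k f S \<longleftrightarrow> C_k_on k g S"
  using assms(2)
proof (induction k arbitrary: f g)
  case 0
  then show ?case
    by (auto intro: continuous_on_cong)
next
  case (Suc k)
  have der: "(f has_derivative D) (at x) \<longleftrightarrow> (g has_derivative D) (at x)" if "x \<in> S" for x D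
    using has_derivative_transform_within_open[OF _ \<open>open S\<close> that, of f D UNIV g]
      has_derivative_transform_within_open[OF _ \<open>open S\<close> that, of g D UNIV f] Suc.prems
    by auto
  then have "frechet_derivative f (at x) v = frechet_derivative g (at x) v" if "x \<in> S" for x v
    using that by (simp add: frechet_derivative_def)
  then have "C_k_on k (\<lambda>x. frechet_derivative f (at x) v) S \<longleftrightarrow>
      C_k_on k (\<lambda>x. frechet_derivative g (at x) v) S" for v
    by (rule Suc.IH)
  moreover have "(\<forall>x\<in>S. f differentiable (at x)) \<longleftrightarrow> (\<forall>x\<in>S. g differentiable (at x))"
    by (simp add: differentiable_def der)
  ultimately show ?case
    by simp
qed

text \<open>Smoothness of a single function needs all its iterated derivatives at once. It suffices to find
  a class of functions that contains it and is closed under taking directional derivatives; then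
  induction over the order of differentiation runs through the class.\<close>

lemma smooth_on_derivative_closed_class:
  assumes "open S"
    and closed: "\<And>f. f \<in> F \<Longrightarrow>
      \<exists>D. (\<forall>x\<in>S. (f has_derivative (\<lambda>v. D v x)) (at x)) \<and> (\<forall>v. D v \<in> F)"
    and "f \<in> F"
  shows "smooth_on f S"
proof -
  have "C_k_on k f S" for k
    using \<open>f \<in> F\<close>
  proof (induction k arbitrary: f)
    case 0
    obtain D where "\<And>x. x \<in> S \<Longrightarrow> (f has_derivative (\<lambda>v. D v x)) (at x)"
      using closed[OF 0] by blast
    then have "continuous_on S f"
      by (rule has_derivative_continuous_on[OF has_derivative_at_withinI])
    then show ?case
      by simp
  next
    case (Suc k)
    obtain D where D: "\<And>x. x \<in> S \<Longrightarrow> (f has_derivative (\<lambda>v. D v x)) (at x)" "\<And>v. D v \<in> F"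
      using closed[OF Suc.prems] by blast
    have "C_k_on k (\<lambda>x. frechet_derivative f (at x) v) S" for v
    proof -
      have "frechet_derivative f (at x) v = D v x" if "x \<in> S" for x
        using frechet_derivative_at[OF D(1)[OF that]] by metis
      then have "C_k_on k (\<lambda>x. frechet_derivative f (at x) v) S \<longleftrightarrow> C_k_on k (D v) S"
        by (rule C_k_on_cong[OF \<open>open S\<close>])
      with Suc.IH[OF D(2)] show ?thesis
        by simp
    qed
    moreover have "\<forall>x\<in>S. f differentiable (at x)"
      using D(1) unfolding differentiable_def by blast
    ultimately show ?case
      by simp
  qed
  with \<open>open S\<close> show ?thesis
    by (simp add: smooth_on_def)
qed

text \<open>Noncommutative rational expressions in a variable \<open>x\<close> whose inverses all exist on \<open>S\<close>. Unlike
  the resolvents alone, this class is closed under directional derivatives, since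
  \<open>(f\<^sup>-\<^sup>1)' = - f\<^sup>-\<^sup>1 f' f\<^sup>-\<^sup>1\<close> is again such an expression.\<close>

inductive_set matrix_rational :: "'a set \<Rightarrow> ('a::euclidean_space \<Rightarrow> real ^ 'n ^ 'n) set"
  for S :: "'a set" where
  const: "(\<lambda>_. C) \<in> matrix_rational S"
| linear: "bounded_linear L \<Longrightarrow> L \<in> matrix_rational S"
| add: "f \<in> matrix_rational S \<Longrightarrow> g \<in> matrix_rational S \<Longrightarrow> (\<lambda>x. f x + g x) \<in> matrix_rational S"
| mult: "f \<in> matrix_rational S \<Longrightarrow> g \<in> matrix_rational S \<Longrightarrow> (\<lambda>x. f x ** g x) \<in> matrix_rational S"
| inv: "f \<in> matrix_rational S \<Longrightarrow> (\<And>x. x \<in> S \<Longrightarrow> invertible (f x)) \<Longrightarrow>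
    (\<lambda>x. matrix_inv (f x)) \<in> matrix_rational S"

lemma matrix_rational_uminus:
  assumes "f \<in> matrix_rational S"
  shows "(\<lambda>x. - f x) \<in> matrix_rational S"
proof -
  have "(\<lambda>x. (- mat 1) ** f x) \<in> matrix_rational S"
    by (rule matrix_rational.mult[OF matrix_rational.const assms])
  then show ?thesis
    by (simp add: bounded_bilinear.minus_left[OF bounded_bilinear_matrix_mult])
qed

text \<open>The rules for sums, products and inverses of derivatives mirror the formation rules of the
  class. The derivative is returned as \<open>D v x\<close>, point last, so that the directional derivative
  \<open>D v\<close> is itself a member of the class.\<close>

lemma matrix_rational_derivative:
  assumes "f \<in> matrix_rational S"
  shows "\<exists>D. (\<forall>x\<in>S. (f has_derivative (\<lambda>v. D v x)) (at x)) \<and> (\<forall>v. D v \<in> matrix_rational S)"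
  using assms
proof induction
  case (const C)
  show ?case
    using matrix_rational.const[of 0] by (intro exI[of _ "\<lambda>_ _. 0"]) simp
next
  case (linear L)
  then show ?case
    by (intro exI[of _ "\<lambda>v _. L v"])
      (simp add: matrix_rational.const bounded_linear_imp_has_derivative)
next
  case (add f g)
  then obtain F G where
    FG: "\<And>x. x \<in> S \<Longrightarrow> (f has_derivative (\<lambda>v. F v x)) (at x)" "\<And>v. F v \<in> matrix_rational S"
      "\<And>x. x \<in> S \<Longrightarrow> (g has_derivative (\<lambda>v. G v x)) (at x)" "\<And>v. G v \<in> matrix_rational S"
    by blast
  then show ?case
    by (intro exI[of _ "\<lambda>v x. F v x + G v x"])
      (simp add: has_derivative_add matrix_rational.add)
next
  case (mult f g)
  then obtain F G where
    FG: "\<And>x. x \<in> S \<Longrightarrow> (f has_derivative (\<lambda>v. F v x)) (at x)" "\<And>v. F v \<in> matrix_rational S"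
      "\<And>x. x \<in> S \<Longrightarrow> (g has_derivative (\<lambda>v. G v x)) (at x)" "\<And>v. G v \<in> matrix_rational S"
    by blast
  have "((\<lambda>x. f x ** g x) has_derivative (\<lambda>v. f x ** G v x + F v x ** g x)) (at x)"
    if "x \<in> S" for x
    using bounded_bilinear.FDERIV[OF bounded_bilinear_matrix_mult FG(1,3)[OF that]] .
  with FG(2,4) mult.hyps show ?case
    by (intro exI[of _ "\<lambda>v x. f x ** G v x + F v x ** g x"])
      (simp add: matrix_rational.add matrix_rational.mult)
next
  case (inv f)
  then obtain F where
    F: "\<And>x. x \<in> S \<Longrightarrow> (f has_derivative (\<lambda>v. F v x)) (at x)" "\<And>v. F v \<in> matrix_rational S"
    by blast
  show ?case
  proof (intro exI[of _ "\<lambda>v x. - (matrix_inv (f x) ** F v x ** matrix_inv (f x))"] conjI ballI allI)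
    fix x assume x: "x \<in> S"
    show "((\<lambda>x. matrix_inv (f x)) has_derivative
        (\<lambda>v. - (matrix_inv (f x) ** F v x ** matrix_inv (f x)))) (at x)"
      using has_derivative_compose[OF F(1)[OF x] has_derivative_matrix_inv[OF inv.hyps(2)[OF x]]] .
  next
    fix v
    show "(\<lambda>x. - (matrix_inv (f x) ** F v x ** matrix_inv (f x))) \<in> matrix_rational S"
      by (intro matrix_rational_uminus matrix_rational.mult matrix_rational.inv inv.hyps F)
  qed
qed

lemma bounded_linear_matrix_vector: "bounded_linear (\<lambda>A :: real ^ 'n ^ 'm. A *v b)"
  by (intro linear_conv_bounded_linear[THEN iffD1] linearI)
    (simp_all add: matrix_vector_mult_add_rdistrib flip: scaleR_matrix_vector_assoc)

lemma smooth_on_matrix_rational_vector: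
  assumes "open S" "f \<in> matrix_rational S"
  shows "smooth_on (\<lambda>x. f x *v b) S"
proof (rule smooth_on_derivative_closed_class[OF \<open>open S\<close>])
  let ?F = "(\<lambda>f x. f x *v b) ` matrix_rational S"
  show "(\<lambda>x. f x *v b) \<in> ?F"
    using assms by blast
  fix h assume "h \<in> ?F"
  then obtain f where h: "h = (\<lambda>x. f x *v b)" and f: "f \<in> matrix_rational S"
    by blast
  obtain D where
    D: "\<And>x. x \<in> S \<Longrightarrow> (f has_derivative (\<lambda>v. D v x)) (at x)" "\<And>v. D v \<in> matrix_rational S"
    using matrix_rational_derivative[OF f] by blast
  then show "\<exists>D. (\<forall>x\<in>S. (h has_derivative (\<lambda>v. D v x)) (at x)) \<and> (\<forall>v. D v \<in> ?F)"
    unfolding h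
    by (intro exI[of _ "\<lambda>v x. D v x *v b"])
      (auto intro!: bounded_linear.has_derivative[OF bounded_linear_matrix_vector])
qed

lemma matpow_matrix_rational: "(\<lambda>A. matpow A k) \<in> matrix_rational S"
proof (induction k)
  case 0
  show ?case
    by (simp add: matrix_rational.const)
next
  case (Suc k)
  from matrix_rational.mult[OF matrix_rational.linear[OF bounded_linear_ident] this] show ?case
    by simp
qed

lemma resolvent_matrix_rational:
  fixes \<alpha> :: real
  assumes "\<And>A :: real ^ 'n ^ 'n. A \<in> S \<Longrightarrow> invertible (mat 1 - \<alpha> *\<^sub>R A)"
  shows "(\<lambda>A. matrix_inv (mat 1 - \<alpha> *\<^sub>R A)) \<in> matrix_rational S"
proof -
  have "(\<lambda>A. mat 1 + (- \<alpha>) *\<^sub>R A) \<in> matrix_rational S"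
    by (rule matrix_rational.add[OF matrix_rational.const
          matrix_rational.linear[OF bounded_linear_scaleR_right]])
  then have "(\<lambda>A. mat 1 - \<alpha> *\<^sub>R A) \<in> matrix_rational S"
    by simp
  then show ?thesis
    using assms by (rule matrix_rational.inv)
qed

section \<open>Smoothness and derivatives of the centralities\<close>

lemma katz_eq_pagerank: "katz \<alpha> = pagerank \<alpha> 1"
  by (simp add: fun_eq_iff katz_def pagerank_def)

lemma open_invertible_pencil: "open {A :: real ^ 'n ^ 'n. invertible (mat 1 - \<alpha> *\<^sub>R A)}"
  unfolding invertible_det_nz by (intro open_Collect_neq continuous_intros)

lemma smooth_on_pagerank: "smooth_on (pagerank \<alpha> \<beta>) {A. invertible (mat 1 - \<alpha> *\<^sub>R A)}"
  unfolding pagerank_def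
  by (intro smooth_on_matrix_rational_vector open_invertible_pencil resolvent_matrix_rational) auto

lemma smooth_on_diffusion: "smooth_on (diffusion \<alpha> S :: real ^ 'n ^ 'n \<Rightarrow> real ^ 'n) UNIV"
proof -
  have "(\<lambda>A :: real ^ 'n ^ 'n. \<Sum>s\<in>I. \<alpha> ^ s *\<^sub>R matpow A s) \<in> matrix_rational UNIV" if "finite I" for I
    using that
  proof induction
    case empty
    show ?case
      by (simp add: matrix_rational.const)
  next
    case (insert s I)
    \<comment> \<open>scaling is a product with a constant matrix\<close>
    have "(\<lambda>A. (\<alpha> ^ s *\<^sub>R mat 1) ** matpow A s) \<in> matrix_rational UNIV"
      by (rule matrix_rational.mult[OF matrix_rational.const matpow_matrix_rational])
    then have "(\<lambda>A :: real ^ 'n ^ 'n. \<alpha> ^ s *\<^sub>R matpow A s) \<in> matrix_rational UNIV"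
      by (simp add: bounded_bilinear.scaleR_left[OF bounded_bilinear_matrix_mult])
    with insert show ?case
      by (simp add: matrix_rational.add)
  qed
  then show ?thesis
    unfolding diffusion_def by (intro smooth_on_matrix_rational_vector) auto
qed

text \<open>A kernel vector of \<open>I - \<alpha> M\<close> is an eigenvector of \<open>M\<close> for the eigenvalue \<open>1 / \<alpha>\<close>, so
  \<open>1 / \<alpha> \<le> \<lambda>\<^sub>m\<^sub>a\<^sub>x\<close>.\<close>

lemma invertible_below_lambda_max:
  fixes M :: "real ^ 'n ^ 'n"
  assumes "0 < \<alpha>" "ereal \<alpha> * lambda_max M < 1"
  shows "invertible (mat 1 - \<alpha> *\<^sub>R M)"
proof (rule ccontr)
  assume "\<not> invertible (mat 1 - \<alpha> *\<^sub>R M)"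
  then obtain v where "v \<noteq> 0" "(mat 1 - \<alpha> *\<^sub>R M) *v v = 0"
    using matrix_left_invertible_ker[of "mat 1 - \<alpha> *\<^sub>R M"]
    by (metis invertible_left_inverse)
  then have "\<alpha> *\<^sub>R (M *v v) = v"
    by (simp add: matrix_vector_mult_diff_rdistrib flip: scaleR_matrix_vector_assoc)
  with \<open>0 < \<alpha>\<close> have "M *v v = (1 / \<alpha>) *\<^sub>R v"
    by (metis less_irrefl nonzero_divide_eq_eq scaleR_one scaleR_scaleR)
  with \<open>v \<noteq> 0\<close> have "1 / \<alpha> \<in> real_eigenvalues M"
    by (auto simp: real_eigenvalues_def)
  then have "ereal (1 / \<alpha>) \<le> lambda_max M"
    unfolding lambda_max_def by (intro Sup_upper) auto
  then have "ereal \<alpha> * ereal (1 / \<alpha>) \<le> ereal \<alpha> * lambda_max M"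
    using \<open>0 < \<alpha>\<close> by (intro ereal_mult_left_mono) auto
  with assms show False
    by (simp add: one_ereal_def)
qed

text \<open>The identity \<open>(u \<otimes> v) vec H = v H u\<^sup>T\<close> for row vectors turns the Kronecker rows \<open>B\<close> into
  linear functionals of a perturbation \<open>H\<close>; it is what identifies them with derivatives.\<close>

lemma kron_inner_vectorize: "kron u v \<bullet> vectorize H = v \<bullet> (H *v u)"
  for u :: "real ^ 'n" and v :: "real ^ 'm"
proof -
  have "kron u v \<bullet> vectorize H = (\<Sum>k\<in>UNIV \<times> UNIV. u $ fst k * v $ snd k * H $ snd k $ fst k)"
    by (simp add: inner_vec_def kron_def vectorize_def)
  also have "\<dots> = (\<Sum>j\<in>UNIV. \<Sum>i\<in>UNIV. u $ j * v $ i * H $ i $ j)"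
    by (simp add: sum.cartesian_product case_prod_beta)
  also have "\<dots> = (\<Sum>i\<in>UNIV. \<Sum>j\<in>UNIV. u $ j * v $ i * H $ i $ j)"
    by (rule sum.swap)
  also have "\<dots> = v \<bullet> (H *v u)"
    by (simp add: inner_vec_def matrix_vector_mult_def sum_distrib_left mult_ac)
  finally show ?thesis .
qed

lemma left_resolvent_transpose:
  fixes M :: "real ^ 'n ^ 'n"
  assumes "invertible (mat 1 - \<alpha> *\<^sub>R M)"
  shows "\<beta> v* matrix_inv (mat 1 - \<alpha> *\<^sub>R transpose M) = matrix_inv (mat 1 - \<alpha> *\<^sub>R M) *v \<beta>"
proof -
  have "transpose (mat 1 - \<alpha> *\<^sub>R M) = mat 1 - \<alpha> *\<^sub>R transpose M"
    by (simp add: transpose_def mat_def vec_eq_iff)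
  then show ?thesis
    using matrix_inv_transpose[OF assms] by simp
qed

text \<open>With \<open>R = (I - \<alpha> M)\<^sup>-\<^sup>1\<close> the derivative of the resolvent in direction \<open>H\<close> is \<open>\<alpha> R H R\<close>. By the
  Kronecker identity, coordinate \<open>i\<close> of \<open>\<alpha> R H R \<beta>\<close> is minus \<open>B\<close> applied to the stacked \<open>H\<close>.\<close>

lemma pagerank_has_derivative:
  fixes M :: "real ^ 'n ^ 'n"
  assumes inv: "invertible (mat 1 - \<alpha> *\<^sub>R M)"
  shows "((\<lambda>A. pagerank \<alpha> \<beta> A $ i) has_derivative (\<lambda>H. - B_pagerank \<alpha> \<beta> M i \<bullet> vectorize H)) (at M)"
proof -
  let ?R = "matrix_inv (mat 1 - \<alpha> *\<^sub>R M)"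
  have "((\<lambda>A. mat 1 - \<alpha> *\<^sub>R A) has_derivative (\<lambda>H. - (\<alpha> *\<^sub>R H))) (at M)"
    by (auto intro!: derivative_eq_intros)
  from has_derivative_compose[OF this has_derivative_matrix_inv[OF inv]]
  have "((\<lambda>A. matrix_inv (mat 1 - \<alpha> *\<^sub>R A)) has_derivative
      (\<lambda>H. - (?R ** - (\<alpha> *\<^sub>R H) ** ?R))) (at M)" .
  from bounded_linear.has_derivative[OF bounded_linear_compose[OF bounded_linear_vec_nth
      bounded_linear_matrix_vector] this]
  have "((\<lambda>A. pagerank \<alpha> \<beta> A $ i) has_derivative
      (\<lambda>H. (- (?R ** - (\<alpha> *\<^sub>R H) ** ?R) *v \<beta>) $ i)) (at M)"
    unfolding pagerank_def .
  moreover have "(- (?R ** - (\<alpha> *\<^sub>R H) ** ?R) *v \<beta>) $ i = - B_pagerank \<alpha> \<beta> M i \<bullet> vectorize H" for H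
  proof -
    have "- B_pagerank \<alpha> \<beta> M i \<bullet> vectorize H = \<alpha> * ((axis i 1 v* ?R) \<bullet> (H *v (?R *v \<beta>)))"
      by (simp add: B_pagerank_def left_resolvent_transpose[OF inv] kron_inner_vectorize matrix_vector_mult_scaleR flip: scaleR_minus_left
          del: scaleR_minus_left)
    also have "\<dots> = \<alpha> * ((?R ** H ** ?R) *v \<beta>) $ i"
      by (simp add: dot_lmul_matrix matrix_vector_mul_assoc inner_axis' matrix_mul_assoc)
    also have "\<dots> = (- (?R ** - (\<alpha> *\<^sub>R H) ** ?R) *v \<beta>) $ i"
      by (simp add: bounded_bilinear.minus_right[OF bounded_bilinear_matrix_mult]
          bounded_bilinear.minus_left[OF bounded_bilinear_matrix_mult]
          bounded_bilinear.scaleR_right[OF bounded_bilinear_matrix_mult]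
          bounded_bilinear.scaleR_left[OF bounded_bilinear_matrix_mult]
          scaleR_matrix_vector_assoc[symmetric])
    finally show ?thesis ..
  qed
  ultimately show ?thesis
    by simp
qed

lemma matpow_commute: "matpow A k ** A = A ** matpow A k"
  by (induction k) (simp_all flip: matrix_mul_assoc)

lemma transpose_matpow: "transpose (matpow A k) = matpow (transpose A) k"
  by (induction k) (simp_all add: matrix_transpose_mul matpow_commute)

text \<open>The product rule differentiates the factors of \<open>A\<^sup>s\<close> one at a time; \<open>j\<close> is the position of the
  factor that is replaced by \<open>H\<close>.\<close>

lemma matpow_has_derivative:
  fixes M :: "real ^ 'n ^ 'n"
  shows "((\<lambda>A. matpow A s) has_derivative
    (\<lambda>H. \<Sum>j = 1..s. matpow M (j - 1) ** H ** matpow M (s - j))) (at M)"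
proof (induction s)
  case 0
  then show ?case
    by simp
next
  case (Suc s)
  interpret mult: bounded_bilinear "(**) :: real ^ 'n ^ 'n \<Rightarrow> real ^ 'n ^ 'n \<Rightarrow> real ^ 'n ^ 'n"
    by (rule bounded_bilinear_matrix_mult)
  have "(\<Sum>j = 1..Suc s. matpow M (j - 1) ** H ** matpow M (Suc s - j)) =
      M ** (\<Sum>j = 1..s. matpow M (j - 1) ** H ** matpow M (s - j)) + H ** matpow M s" for H
  proof -
    have "(\<Sum>j = 1..Suc s. matpow M (j - 1) ** H ** matpow M (Suc s - j)) =
        H ** matpow M s + (\<Sum>j = Suc 1..Suc s. matpow M (j - 1) ** H ** matpow M (Suc s - j))"
      by (subst sum.atLeast_Suc_atMost) auto
    also have "(\<Sum>j = Suc 1..Suc s. matpow M (j - 1) ** H ** matpow M (Suc s - j)) =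
        (\<Sum>j = 1..s. matpow M j ** H ** matpow M (s - j))"
      by (subst sum.shift_bounds_cl_Suc_ivl) simp
    also have "\<dots> = (\<Sum>j = 1..s. M ** (matpow M (j - 1) ** H ** matpow M (s - j)))"
    proof (rule sum.cong)
      fix j assume "j \<in> {1..s}"
      then have "matpow M j = M ** matpow M (j - 1)"
        by (cases j) auto
      then show "matpow M j ** H ** matpow M (s - j) = M ** (matpow M (j - 1) ** H ** matpow M (s - j))"
        by (simp add: matrix_mul_assoc)
    qed simp
    finally show ?thesis
      by (simp add: mult.sum_right)
  qed
  then show ?case
    using mult.FDERIV[OF has_derivative_ident Suc.IH] by simp
qed

lemma diffusion_has_derivative:
  fixes M :: "real ^ 'n ^ 'n"
  shows "((\<lambda>A. diffusion \<alpha> S A $ i) has_derivative (\<lambda>H. B_diffusion \<alpha> S M i \<bullet> vectorize H)) (at M)"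
proof -
  let ?D = "\<lambda>H s. \<Sum>j = 1..s. matpow M (j - 1) ** H ** matpow M (s - j)"
  have "((\<lambda>A. \<Sum>s = 0..S. \<alpha> ^ s *\<^sub>R matpow A s) has_derivative (\<lambda>H. \<Sum>s = 0..S. \<alpha> ^ s *\<^sub>R ?D H s)) (at M)"
    by (intro has_derivative_sum has_derivative_scaleR_right matpow_has_derivative)
  from bounded_linear.has_derivative[OF bounded_linear_compose[OF bounded_linear_vec_nth
      bounded_linear_matrix_vector] this]
  have "((\<lambda>A. diffusion \<alpha> S A $ i) has_derivative
      (\<lambda>H. ((\<Sum>s = 0..S. \<alpha> ^ s *\<^sub>R ?D H s) *v 1) $ i)) (at M)"
    unfolding diffusion_def .
  moreover have "((\<Sum>s = 0..S. \<alpha> ^ s *\<^sub>R ?D H s) *v 1) $ i = B_diffusion \<alpha> S M i \<bullet> vectorize H" for H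
  proof -
    interpret ev: bounded_linear "\<lambda>A :: real ^ 'n ^ 'n. (A *v 1) $ i"
      by (intro bounded_linear_compose[OF bounded_linear_vec_nth bounded_linear_matrix_vector])
    have "kron (1 v* matpow (transpose M) k) (axis i 1 v* matpow M l) \<bullet> vectorize H =
        ((matpow M l ** H ** matpow M k) *v 1) $ i" for k l
      by (simp add: kron_inner_vectorize dot_lmul_matrix matrix_vector_mul_assoc inner_axis' matrix_mul_assoc
          flip: transpose_matpow)
    then show ?thesis
      by (simp add: B_diffusion_def inner_sum_left ev.sum ev.scaleR)
  qed
  ultimately show ?thesis
    by simp
qed

lemma kron_eq_0_iff: "kron u v = 0 \<longleftrightarrow> u = 0 \<or> v = 0"
  by (auto simp: kron_def vec_eq_iff)

text \<open>\<open>R \<beta>\<close> and row \<open>i\<close> of \<open>R\<close> cannot vanish as \<open>R\<close> is invertible. Since \<open>\<Omega>\<close> is positive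
  definite, this makes the asymptotic variance of the Katz centrality positive.\<close>

lemma B_pagerank_nonzero:
  fixes M :: "real ^ 'n ^ 'n"
  assumes inv: "invertible (mat 1 - \<alpha> *\<^sub>R M)" and "\<alpha> \<noteq> 0" "\<beta> \<noteq> 0"
  shows "B_pagerank \<alpha> \<beta> M i \<noteq> 0"
proof -
  let ?R = "matrix_inv (mat 1 - \<alpha> *\<^sub>R M)"
  have "(mat 1 - \<alpha> *\<^sub>R M) *v (?R *v \<beta>) = \<beta>"
    by (simp add: matrix_vector_mul_assoc matrix_inv_right[OF inv])
  with \<open>\<beta> \<noteq> 0\<close> have "?R *v \<beta> \<noteq> 0"
    by auto
  moreover have "(axis i 1 v* ?R) v* (mat 1 - \<alpha> *\<^sub>R M) = axis i 1"
    by (simp add: vector_matrix_mul_assoc matrix_inv_left[OF inv])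
  then have "axis i 1 v* ?R \<noteq> 0"
    by (metis axis_eq_0_iff vector_matrix_mult_0 zero_neq_one)
  ultimately show ?thesis
    using \<open>\<alpha> \<noteq> 0\<close> by (simp add: B_pagerank_def kron_eq_0_iff left_resolvent_transpose[OF inv])
qed

lemma borel_measurable_pagerank:
  "(\<lambda>A :: real ^ 'n ^ 'n. pagerank \<alpha> \<beta> A $ i) \<in> borel_measurable borel"
proof -
  have "(\<lambda>A :: real ^ 'n ^ 'n. mat 1 - \<alpha> *\<^sub>R A) \<in> borel_measurable borel"
    by (intro borel_measurable_continuous_onI continuous_intros)
  then have 1: "(\<lambda>A :: real ^ 'n ^ 'n. matrix_inv (mat 1 - \<alpha> *\<^sub>R A)) \<in> borel_measurable borel"
    by (rule measurable_compose[OF _ borel_measurable_matrix_inv])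
  have "(\<lambda>A :: real ^ 'n ^ 'n. (A *v \<beta>) $ i) \<in> borel_measurable borel"
    by (intro borel_measurable_continuous_onI linear_continuous_on
        bounded_linear_compose[OF bounded_linear_vec_nth bounded_linear_matrix_vector])
  from measurable_compose[OF 1 this] show ?thesis
    unfolding pagerank_def .
qed

lemma continuous_on_diffusion: "continuous_on UNIV (\<lambda>A :: real ^ 'n ^ 'n. diffusion \<alpha> S A $ i)"
  by (rule has_derivative_continuous_on[OF has_derivative_at_withinI[OF diffusion_has_derivative]])

section \<open>The standard normal law is determined by its moment generating function\<close>

text \<open>Finiteness of all exponential moments makes \<open>z \<mapsto> E exp (z X)\<close> an entire function, with Taylor
  coefficients \<open>E X\<^sup>k / k!\<close>. It agrees with \<open>exp (z\<^sup>2 / 2)\<close> on the real line, hence everywhere,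
  in particular on the imaginary axis, where it is the characteristic function.\<close>

lemma mgf_std_normal_unique:
  assumes \<mu>: "real_distribution \<mu>"
    and mgf: "\<And>s. (\<integral>\<^sup>+x. ennreal (exp (s * x)) \<partial>\<mu>) = ennreal (exp (s\<^sup>2 / 2))"
  shows "\<mu> = std_normal_distribution"
proof (rule Levy_uniqueness[OF \<mu> real_dist_normal_dist])
  interpret real_distribution \<mu>
    by (rule \<mu>)
  have real_mgf: "integrable \<mu> (\<lambda>x. exp (s * x)) \<and> (\<integral>x. exp (s * x) \<partial>\<mu>) = exp (s\<^sup>2 / 2)" for s
    using mgf[of s] by (subst (asm) nn_integral_eq_integrable) auto
  have dominating: "integrable \<mu> (\<lambda>x. exp (r * \<bar>x\<bar>))" for r
  proof (rule Bochner_Integration.integrable_bound)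
    show "integrable \<mu> (\<lambda>x. exp (r * x) + exp (- r * x))"
      by (intro Bochner_Integration.integrable_add) (use real_mgf in blast)+
    have "exp (r * \<bar>x\<bar>) \<le> exp (r * x) + exp (- r * x)" for x :: real
      by (cases "0 \<le> x") auto
    then show "AE x in \<mu>. norm (exp (r * \<bar>x\<bar>)) \<le> norm (exp (r * x) + exp (- r * x))"
      by simp
  qed simp
  define G where "G z = (\<integral>x. exp (z * complex_of_real x) \<partial>\<mu>)" for z
  define m where "m k = (\<integral>x. complex_of_real x ^ k / fact k \<partial>\<mu>)" for k
  have G_sums: "(\<lambda>k. m k * z ^ k) sums G z" for z
  proof -
    let ?f = "\<lambda>k x. (z * complex_of_real x) ^ k / fact k"
    let ?r = "cmod z"
    have norm_f: "norm (?f k x) = (?r * \<bar>x\<bar>) ^ k / fact k" for k x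
      by (simp add: norm_divide norm_power norm_mult)
    have f_sums: "(\<lambda>k. norm (?f k x)) sums exp (?r * \<bar>x\<bar>)" for x
      using exp_converges[of "?r * \<bar>x\<bar>"] unfolding norm_f by (simp add: divide_inverse mult.commute)
    have partial: "(\<Sum>k<n. norm (?f k x)) \<le> exp (?r * \<bar>x\<bar>)" for n x
      using sum_le_suminf[OF sums_summable[OF f_sums], of "{..<n}" x] sums_unique[OF f_sums, of x]
      by simp
    have int_f: "integrable \<mu> (?f k)" for k
    proof (rule Bochner_Integration.integrable_bound[OF dominating[of ?r]])
      have "norm (?f k x) \<le> exp (?r * \<bar>x\<bar>)" for x
        using sum_le_suminf[OF sums_summable[OF f_sums], of "{k}" x] sums_unique[OF f_sums, of x]
        by simp
      then show "AE x in \<mu>. norm (?f k x) \<le> norm (exp (?r * \<bar>x\<bar>))"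
        by simp
    qed simp
    have "summable (\<lambda>k. \<integral>x. norm (?f k x) \<partial>\<mu>)"
    proof (rule summableI_nonneg_bounded)
      fix n
      have "(\<Sum>k<n. \<integral>x. norm (?f k x) \<partial>\<mu>) = (\<integral>x. (\<Sum>k<n. norm (?f k x)) \<partial>\<mu>)"
        by (intro Bochner_Integration.integral_sum[symmetric] integrable_norm int_f)
      also have "\<dots> \<le> (\<integral>x. exp (?r * \<bar>x\<bar>) \<partial>\<mu>)"
        by (intro integral_mono Bochner_Integration.integrable_sum integrable_norm int_f dominating partial)
      finally show "(\<Sum>k<n. \<integral>x. norm (?f k x) \<partial>\<mu>) \<le> (\<integral>x. exp (?r * \<bar>x\<bar>) \<partial>\<mu>)" .
    qed (simp add: integral_nonneg_AE)
    then have "(\<lambda>k. \<integral>x. ?f k x \<partial>\<mu>) sums (\<integral>x. (\<Sum>k. ?f k x) \<partial>\<mu>)"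
      by (intro sums_integral int_f) (auto intro: sums_summable[OF f_sums])
    moreover have "(\<integral>x. ?f k x \<partial>\<mu>) = m k * z ^ k" for k
    proof -
      have "?f k x = z ^ k * (complex_of_real x ^ k / fact k)" for x
        by (simp add: power_mult_distrib)
      then show ?thesis
        by (simp add: m_def mult.commute)
    qed
    moreover have "(\<Sum>k. ?f k x) = exp (z * complex_of_real x)" for x
      using exp_converges[of "z * complex_of_real x"]
      by (simp add: sums_iff scaleR_conv_of_real divide_inverse mult.commute)
    ultimately show ?thesis
      by (simp add: G_def)
  qed
  \<comment> \<open>a power series that converges everywhere is entire\<close>
  have holo: "G holomorphic_on UNIV"
  proof -
    have "G holomorphic_on ball 0 r" for r
      using G_sums by (intro power_series_holomorphic[of 0 r m]) auto
    then show ?thesis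
      unfolding holomorphic_on_def
      by (metis UNIV_I at_within_open centre_in_ball dist_norm gt_ex mem_ball open_UNIV open_ball)
  qed
  have "G z - exp (z\<^sup>2 / 2) = 0" for z
  proof (rule analytic_continuation[where f = "\<lambda>z. G z - exp (z\<^sup>2 / 2)" and S = UNIV and U = \<real> and \<xi> = 0])
    show "(\<lambda>z. G z - exp (z\<^sup>2 / 2)) holomorphic_on UNIV"
      by (intro holomorphic_intros holo) auto
    show "(0 :: complex) islimpt \<real>"
    proof (rule islimptI)
      fix T :: "complex set" assume "0 \<in> T" "open T"
      then obtain e where e: "e > 0" "ball 0 e \<subseteq> T"
        by (meson openE)
      then have "complex_of_real (e / 2) \<in> T"
        by (auto simp: subset_iff)
      with e show "\<exists>y\<in>\<real>. y \<in> T \<and> y \<noteq> 0"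
        by (intro bexI[of _ "complex_of_real (e / 2)"]) auto
    qed
    fix w :: complex assume "w \<in> \<real>"
    then obtain s where w: "w = of_real s"
      by (auto elim: Reals_cases)
    have "G w = (\<integral>x. complex_of_real (exp (s * x)) \<partial>\<mu>)"
      by (simp add: G_def w exp_of_real[symmetric])
    also have "\<dots> = complex_of_real (\<integral>x. exp (s * x) \<partial>\<mu>)"
      by (rule integral_of_real) (use real_mgf in blast)
    finally show "G w - exp (w\<^sup>2 / 2) = 0"
      using real_mgf[of s] by (simp add: w exp_of_real[symmetric])
  qed auto
  then have G: "G z = exp (z\<^sup>2 / 2)" for z
    by simp
  have "char \<mu> t = exp (- (t\<^sup>2) / 2)" for t
  proof -
    have "char \<mu> t = G (\<i> * of_real t)"
      by (simp add: char_def G_def mult.assoc)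
    also have "\<dots> = exp (- (of_real t)\<^sup>2 / 2)"
      by (simp add: G power_mult_distrib)
    finally show ?thesis
      by (simp add: exp_of_real[symmetric])
  qed
  then show "char \<mu> = char std_normal_distribution"
    by (simp add: char_std_normal_distribution fun_eq_iff)
qed

section \<open>Linear functionals of a centred normal vector\<close>

lemma matrix_inv_mult_positive_definite:
  fixes A :: "real ^ 'n ^ 'n"
  assumes "positive_definite A"
  shows "matrix_inv A ** A = mat 1" "A ** matrix_inv A = mat 1"
proof -
  have "v = 0" if "A *v v = 0" for v
    using that assms unfolding positive_definite_def by (metis inner_zero_right less_irrefl)
  then have "invertible A"
    using matrix_left_invertible_ker[of A] by (simp add: invertible_left_inverse)
  then show "matrix_inv A ** A = mat 1" "A ** matrix_inv A = mat 1"
    by (simp_all add: matrix_inv_left matrix_inv_right)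
qed

lemma asymp_var_pos:
  assumes "positive_definite \<Omega>" "b \<noteq> 0"
  shows "0 < asymp_var \<Omega> b"
  using assms by (simp add: positive_definite_def asymp_var_def dot_lmul_matrix)

text \<open>Completing the square: tilting the density by \<open>exp (b \<bullet> x)\<close> translates it by \<open>\<Omega> b\<close>, up to the
  constant factor \<open>exp (b \<Omega> b\<^sup>T / 2)\<close>, and Lebesgue measure is translation invariant. The
  total mass remains as a factor; it becomes \<open>1\<close> once the normal law is known to be a limit of
  probability laws.\<close>

lemma multi_normal_mgf:
  fixes \<Omega> :: "real ^ 'n ^ 'n"
  assumes pd: "positive_definite \<Omega>"
  shows "(\<integral>\<^sup>+x. ennreal (exp (b \<bullet> x)) \<partial>multi_normal \<Omega>) =
    ennreal (exp (asymp_var \<Omega> b / 2)) * emeasure (multi_normal \<Omega>) UNIV"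
proof -
  let ?Q = "matrix_inv \<Omega>"
  define c where "c = sqrt ((2 * pi) ^ CARD('n) * det \<Omega>)"
  define \<rho> where "\<rho> x = ennreal (exp (- (x \<bullet> (?Q *v x)) / 2) / c)" for x
  define u where "u = \<Omega> *v b"
  have [measurable]: "\<rho> \<in> borel_measurable borel"
    unfolding \<rho>_def divide_inverse
    by (intro measurable_compose[OF _ measurable_ennreal] borel_measurable_continuous_onI continuous_intros
        linear_continuous_on matrix_vector_mul_bounded_linear)
  have N: "multi_normal \<Omega> = density lborel \<rho>"
    by (simp only: multi_normal_def \<rho>_def[abs_def] c_def)
  have Qu: "?Q *v u = b"
    by (simp add: u_def matrix_vector_mul_assoc matrix_inv_mult_positive_definite[OF pd])
  have uQ: "u \<bullet> (?Q *v x) = b \<bullet> x" for x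
  proof -
    have "u \<bullet> (?Q *v x) = b \<bullet> (\<Omega> *v (?Q *v x))"
      using pd unfolding u_def positive_definite_def
      by (metis dot_lmul_matrix transpose_matrix_vector)
    then show ?thesis
      by (simp add: matrix_vector_mul_assoc matrix_inv_mult_positive_definite[OF pd])
  qed
  have var: "asymp_var \<Omega> b = b \<bullet> u"
    by (simp add: asymp_var_def u_def dot_lmul_matrix)
  have shift: "\<rho> x * ennreal (exp (b \<bullet> x)) = ennreal (exp (asymp_var \<Omega> b / 2)) * \<rho> (- u + x)" for x
  proof -
    have "(- u + x) \<bullet> (?Q *v (- u + x)) = x \<bullet> (?Q *v x) - 2 * (b \<bullet> x) + b \<bullet> u"
    proof -
      have "?Q *v (- u + x) = - b + ?Q *v x"
        using Qu by (simp add: matrix_vector_mult_diff_distrib flip: diff_conv_add_uminus add: add.commute)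
      then show ?thesis
        using uQ[of x]
        by (simp add: inner_diff_left inner_diff_right inner_commute[of x b] inner_commute[of u b])
    qed
    then have "exp (- (x \<bullet> (?Q *v x)) / 2) * exp (b \<bullet> x) =
        exp (asymp_var \<Omega> b / 2) * exp (- ((- u + x) \<bullet> (?Q *v (- u + x))) / 2)"
      by (simp add: var field_simps flip: exp_add)
    then have scaled: "exp (- (x \<bullet> (?Q *v x)) / 2) / c * exp (b \<bullet> x) =
        exp (asymp_var \<Omega> b / 2) * (exp (- ((- u + x) \<bullet> (?Q *v (- u + x))) / 2) / c)"
      by simp
    have "\<rho> x * ennreal (exp (b \<bullet> x)) = ennreal (exp (- (x \<bullet> (?Q *v x)) / 2) / c * exp (b \<bullet> x))"
      unfolding \<rho>_def by (rule ennreal_mult''[symmetric]) simp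
    also have "\<dots> = ennreal (exp (asymp_var \<Omega> b / 2)) * \<rho> (- u + x)"
      unfolding \<rho>_def scaled by (rule ennreal_mult') simp
    finally show ?thesis .
  qed
  have "(\<integral>\<^sup>+x. ennreal (exp (b \<bullet> x)) \<partial>multi_normal \<Omega>) = (\<integral>\<^sup>+x. \<rho> x * ennreal (exp (b \<bullet> x)) \<partial>lborel)"
    unfolding N by (subst nn_integral_density) auto
  also have "\<dots> = (\<integral>\<^sup>+x. ennreal (exp (asymp_var \<Omega> b / 2)) * \<rho> (- u + x) \<partial>lborel)"
    by (simp only: shift)
  also have "\<dots> = ennreal (exp (asymp_var \<Omega> b / 2)) * (\<integral>\<^sup>+x. \<rho> (- u + x) \<partial>lborel)"
    by (rule nn_integral_cmult) simp
  also have "(\<integral>\<^sup>+x. \<rho> (- u + x) \<partial>lborel) = (\<integral>\<^sup>+x. \<rho> x \<partial>distr lborel borel ((+) (- u)))"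
    by (subst nn_integral_distr) auto
  also have "\<dots> = emeasure (multi_normal \<Omega>) UNIV"
    unfolding N by (simp add: lborel_distr_plus emeasure_density)
  finally show ?thesis .
qed

lemma sets_multi_normal [simp, measurable_cong]: "sets (multi_normal \<Omega>) = sets borel"
  by (simp add: multi_normal_def)

lemma space_multi_normal [simp]: "space (multi_normal \<Omega>) = UNIV"
  by (simp add: multi_normal_def)

lemma distr_multi_normal_inner:
  fixes \<Omega> :: "real ^ 'n ^ 'n"
  assumes pd: "positive_definite \<Omega>" and "prob_space (multi_normal \<Omega>)" and "b \<noteq> 0"
  shows "distr (multi_normal \<Omega>) borel (\<lambda>x. (b \<bullet> x) / sqrt (asymp_var \<Omega> b)) = std_normal_distribution"
proof (rule mgf_std_normal_unique)
  interpret prob_space "multi_normal \<Omega>" by fact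
  let ?\<sigma> = "sqrt (asymp_var \<Omega> b)"
  have pos: "asymp_var \<Omega> b > 0"
    using pd \<open>b \<noteq> 0\<close> by (rule asymp_var_pos)
  show "real_distribution (distr (multi_normal \<Omega>) borel (\<lambda>x. (b \<bullet> x) / ?\<sigma>))"
    by (intro real_distribution_distr) simp
  fix s
  let ?c = "(s / ?\<sigma>) *\<^sub>R b"
  have "asymp_var \<Omega> ?c = (s / ?\<sigma>)\<^sup>2 * asymp_var \<Omega> b"
    by (simp add: asymp_var_def scaleR_vector_matrix_assoc power2_eq_square)
  also have "\<dots> = s\<^sup>2"
    using pos by (simp add: power_divide)
  finally have var: "asymp_var \<Omega> ?c = s\<^sup>2" .
  have "(\<integral>\<^sup>+x. ennreal (exp (s * x)) \<partial>distr (multi_normal \<Omega>) borel (\<lambda>x. (b \<bullet> x) / ?\<sigma>)) =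
      (\<integral>\<^sup>+x. ennreal (exp (?c \<bullet> x)) \<partial>multi_normal \<Omega>)"
    by (subst nn_integral_distr) (auto simp: mult.commute)
  also have "\<dots> = ennreal (exp (s\<^sup>2 / 2))"
    using emeasure_space_1 by (simp only: multi_normal_mgf[OF pd] var) simp
  finally show "(\<integral>\<^sup>+x. ennreal (exp (s * x)) \<partial>distr (multi_normal \<Omega>) borel (\<lambda>x. (b \<bullet> x) / ?\<sigma>)) =
      ennreal (exp (s\<^sup>2 / 2))" .
qed

section \<open>Convergence in probability and in distribution\<close>

lemma converges_in_prob_continuous:
  fixes X :: "nat \<Rightarrow> 'w \<Rightarrow> 'a::{metric_space,second_countable_topology}"
    and h :: "'a \<Rightarrow> 'b::metric_space"
  assumes prob: "\<And>n. prob_space (P n)" and X[measurable]: "\<And>n. X n \<in> borel_measurable (P n)"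
    and conv: "converges_in_prob P X c" and cont: "isCont h c"
  shows "converges_in_prob P (\<lambda>n \<omega>. h (X n \<omega>)) (h c)"
  unfolding converges_in_prob_def
proof (intro allI impI)
  fix e :: real assume "e > 0"
  then obtain d where d: "d > 0" "\<And>x. dist x c < d \<Longrightarrow> dist (h x) (h c) < e"
    using cont unfolding continuous_at_eps_delta by blast
  have "(\<lambda>n. measure (P n) {\<omega> \<in> space (P n). dist (X n \<omega>) c > d / 2}) \<longlonglongrightarrow> 0"
    using conv half_gt_zero[OF d(1)] unfolding converges_in_prob_def by blast
  then show "(\<lambda>n. measure (P n) {\<omega> \<in> space (P n). dist (h (X n \<omega>)) (h c) > e}) \<longlonglongrightarrow> 0"
  proof (rule Lim_null_comparison[rotated], intro always_eventually allI)
    fix n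
    interpret prob_space "P n" by (rule prob)
    have "dist (X n \<omega>) c > d / 2" if "dist (h (X n \<omega>)) (h c) > e" for \<omega>
      using d(1) d(2)[of "X n \<omega>"] that by force
    then have "measure (P n) {\<omega> \<in> space (P n). dist (h (X n \<omega>)) (h c) > e} \<le>
        measure (P n) {\<omega> \<in> space (P n). dist (X n \<omega>) c > d / 2}"
      by (intro finite_measure_mono) auto
    then show "norm (measure (P n) {\<omega> \<in> space (P n). dist (h (X n \<omega>)) (h c) > e}) \<le>
        measure (P n) {\<omega> \<in> space (P n). dist (X n \<omega>) c > d / 2}"
      by simp
  qed
qed

text \<open>No mass is lost in the limit, because the constant function \<open>1\<close> is an admissible test function.
  In particular, a normal law that is known as a limit has total mass \<open>1\<close>.\<close>

lemma converges_in_distr_prob_space: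
  assumes prob: "\<And>n. prob_space (P n)" and conv: "converges_in_distr P X N"
  shows "prob_space N"
proof
  have "(\<lambda>n. \<integral>\<omega>. 1 \<partial>P n) \<longlonglongrightarrow> (\<integral>x. (1::real) \<partial>N)"
    using conv unfolding converges_in_distr_def by (elim allE[of _ "\<lambda>_. 1"]) auto
  then have "(\<lambda>n. 1) \<longlonglongrightarrow> measure N (space N)"
    using prob by (simp add: prob_space.prob_space)
  then have "measure N (space N) = 1"
    by (simp add: LIMSEQ_const_iff)
  then show "emeasure N (space N) = 1"
    by (metis emeasure_eq_ennreal_measure ennreal_1 measure_zero_top zero_neq_one)
qed

text \<open>The real and imaginary parts \<open>cos (g x)\<close> and \<open>sin (g x)\<close> are bounded and continuous.\<close>

lemma converges_in_distr_iexp: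
  fixes X :: "nat \<Rightarrow> 'w \<Rightarrow> 'a::{second_countable_topology,t2_space}" and g :: "'a \<Rightarrow> real"
  assumes prob: "\<And>n. prob_space (P n)" and X[measurable]: "\<And>n. X n \<in> borel_measurable (P n)"
    and N: "sets N = sets borel" and conv: "converges_in_distr P X N" and g: "continuous_on UNIV g"
  shows "(\<lambda>n. \<integral>\<omega>. iexp (g (X n \<omega>)) \<partial>P n) \<longlonglongrightarrow> (\<integral>x. iexp (g x) \<partial>N)"
proof -
  note [measurable_cong] = N
  have [measurable]: "g \<in> borel_measurable borel"
    using g by (rule borel_measurable_continuous_onI)
  have P: "integrable (P n) (\<lambda>\<omega>. iexp (g (X n \<omega>)))" for n
  proof -
    interpret prob_space "P n" by (rule prob)
    show ?thesis by (rule integrable_const_bound[of _ 1]) auto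
  qed
  have N: "integrable N (\<lambda>x. iexp (g x))"
  proof -
    interpret prob_space N by (rule converges_in_distr_prob_space[OF prob conv])
    show ?thesis by (rule integrable_const_bound[of _ 1]) auto
  qed
  have c: "(\<lambda>n. \<integral>\<omega>. cos (g (X n \<omega>)) \<partial>P n) \<longlonglongrightarrow> (\<integral>x. cos (g x) \<partial>N)"
  proof -
    have "bounded (range (\<lambda>x. cos (g x)))"
      by (auto intro!: boundedI[of _ 1])
    with conv continuous_on_cos[OF g] show ?thesis
      unfolding converges_in_distr_def by blast
  qed
  have s: "(\<lambda>n. \<integral>\<omega>. sin (g (X n \<omega>)) \<partial>P n) \<longlonglongrightarrow> (\<integral>x. sin (g x) \<partial>N)"
  proof -
    have "bounded (range (\<lambda>x. sin (g x)))"
      by (auto intro!: boundedI[of _ 1])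
    with conv continuous_on_sin[OF g] show ?thesis
      unfolding converges_in_distr_def by blast
  qed
  show ?thesis
    unfolding tendsto_complex_iff using c s P N
    by (simp add: integral_Re[symmetric] integral_Im[symmetric] Re_exp Im_exp)
qed

lemma iexp_diff_le: "cmod (iexp a - iexp b) \<le> \<bar>a - b\<bar>"
proof -
  have "iexp a - iexp b = iexp b * (iexp (a - b) - 1)"
    by (simp add: right_diff_distrib flip: exp_add)
  then have "cmod (iexp a - iexp b) = cmod (iexp (a - b) - 1)"
    by (simp add: norm_mult)
  also have "\<dots> \<le> \<bar>a - b\<bar>"
    using iexp_approx1[of "a - b" 0] by simp
  finally show ?thesis .
qed

text \<open>A continuous substitute for the indicator of \<open>norm x > m\<close>: it is an admissible test function for
  convergence in distribution, and it equals \<open>1\<close> as soon as \<open>norm x \<ge> m + 1\<close>.\<close>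

definition tail_cutoff :: "nat \<Rightarrow> 'a::real_normed_vector \<Rightarrow> real" where
  "tail_cutoff m x = max 0 (min 1 (norm x - real m))"

lemma tail_cutoff_vanishes:
  fixes N :: "'a::euclidean_space measure"
  assumes "prob_space N" and N[measurable_cong]: "sets N = sets borel"
  shows "(\<lambda>m. \<integral>x. tail_cutoff m x \<partial>N) \<longlonglongrightarrow> 0"
proof -
  interpret prob_space N by fact
  have "(\<lambda>m. \<integral>x. tail_cutoff m x \<partial>N) \<longlonglongrightarrow> (\<integral>x. 0 \<partial>N)"
  proof (rule integral_dominated_convergence[where w = "\<lambda>_. 1"])
    show "AE x in N. (\<lambda>m. tail_cutoff m x) \<longlonglongrightarrow> 0"
    proof (intro AE_I2 tendsto_eventually)
      fix x :: 'a
      obtain k where "norm x \<le> real k"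
        using real_arch_simple by blast
      then show "\<forall>\<^sub>F m in sequentially. tail_cutoff m x = 0"
        by (intro eventually_sequentiallyI[of k]) (auto simp: tail_cutoff_def)
    qed
  qed (auto simp: tail_cutoff_def)
  then show ?thesis
    by simp
qed

text \<open>Write \<open>X\<close> for the scaled error of the estimator and \<open>Y\<close> for that of its image under \<open>h\<close>. By
  differentiability \<open>\<bar>Y - D X\<bar>\<close> is at most \<open>c * norm X\<close>, with \<open>c\<close> as small as desired, as long as \<open>X\<close> stays
  bounded by \<open>K\<close> and \<open>n\<close> is large; the cut-off controls the probability that \<open>X\<close> leaves this ball
  (tightness). So the characteristic functions of \<open>Y\<close> and of \<open>D X\<close> have the same limit, and Levy's
  continuity theorem applies.\<close>

theorem delta_method:
  fixes T :: "nat \<Rightarrow> 'w \<Rightarrow> 'a::euclidean_space" and h :: "'a \<Rightarrow> real"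
  assumes prob: "\<And>n. prob_space (P n)" and T[measurable]: "\<And>n. T n \<in> borel_measurable (P n)"
    and N[measurable_cong]: "sets N = sets borel"
    and conv: "converges_in_distr P (\<lambda>n \<omega>. sqrt (real n) *\<^sub>R (T n \<omega> - \<theta>)) N"
    and h[measurable]: "h \<in> borel_measurable borel" and der: "(h has_derivative D) (at \<theta>)"
  shows "weak_conv_m (\<lambda>n. distr (P n) borel (\<lambda>\<omega>. sqrt (real n) * (h (T n \<omega>) - h \<theta>))) (distr N borel D)"
proof (rule levy_continuity)
  define X where "X n \<omega> = sqrt (real n) *\<^sub>R (T n \<omega> - \<theta>)" for n \<omega>
  define Y where "Y n \<omega> = sqrt (real n) * (h (T n \<omega>) - h \<theta>)" for n \<omega>
  have [measurable]: "X n \<in> borel_measurable (P n)" "Y n \<in> borel_measurable (P n)" for n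
    unfolding X_def Y_def by measurable
  interpret D: bounded_linear D
    using der by (rule has_derivative_bounded_linear)
  have D_cont: "continuous_on UNIV D"
    by (rule linear_continuous_on) (rule D.bounded_linear_axioms)
  then have [measurable]: "D \<in> borel_measurable borel"
    by (rule borel_measurable_continuous_onI)
  have conv: "converges_in_distr P X N"
    using conv by (simp add: X_def[abs_def])
  interpret N: prob_space N
    by (rule converges_in_distr_prob_space[OF prob conv])
  show "real_distribution (distr N borel D)"
    by (rule N.real_distribution_distr) simp
  show "real_distribution (distr (P n) borel (\<lambda>\<omega>. sqrt (real n) * (h (T n \<omega>) - h \<theta>)))" for n
    by (intro prob_space.real_distribution_distr[OF prob]) simp
  fix t :: real
  have lim: "(\<lambda>n. \<integral>\<omega>. iexp (t * D (X n \<omega>)) \<partial>P n) \<longlonglongrightarrow> (\<integral>x. iexp (t * D x) \<partial>N)"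
    by (rule converges_in_distr_iexp[OF prob _ N conv]) (auto intro: continuous_intros D_cont)
  have diff: "(\<lambda>n. (\<integral>\<omega>. iexp (t * Y n \<omega>) \<partial>P n) - (\<integral>\<omega>. iexp (t * D (X n \<omega>)) \<partial>P n)) \<longlonglongrightarrow> 0"
  proof (rule LIMSEQ_I)
    fix e :: real assume "e > 0"
    define \<eta> where "\<eta> = e / 3"
    have "\<eta> > 0"
      using \<open>e > 0\<close> by (simp add: \<eta>_def)
    have "\<forall>\<^sub>F m in sequentially. (\<integral>x. tail_cutoff m x \<partial>N) < \<eta>"
      using tail_cutoff_vanishes[OF N.prob_space_axioms N] \<open>\<eta> > 0\<close> by (rule order_tendstoD)
    then obtain m where m: "(\<integral>x. tail_cutoff m x \<partial>N) < \<eta>"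
      by (auto simp: eventually_sequentially)
    have "(\<lambda>n. \<integral>\<omega>. tail_cutoff m (X n \<omega>) \<partial>P n) \<longlonglongrightarrow> (\<integral>x. tail_cutoff m x \<partial>N)"
    proof -
      have "continuous_on UNIV (tail_cutoff m :: 'a \<Rightarrow> real)" "bounded (range (tail_cutoff m :: 'a \<Rightarrow> real))"
        unfolding tail_cutoff_def by (auto intro!: continuous_intros boundedI[of _ 1])
      with conv show ?thesis
        unfolding converges_in_distr_def by blast
    qed
    then have tight: "\<forall>\<^sub>F n in sequentially. (\<integral>\<omega>. tail_cutoff m (X n \<omega>) \<partial>P n) < \<eta>"
      using m by (rule order_tendstoD)
    \<comment> \<open>\<open>K\<close> is where the cut-off reaches \<open>1\<close>; with this \<open>c\<close> the linearisation error, multiplied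
      by \<open>t\<close>, is at most \<open>\<eta>\<close> on the ball of radius \<open>K\<close>\<close>
    define K where "K = real m + 1"
    define c where "c = \<eta> / (K * (\<bar>t\<bar> + 1))"
    have "K > 0" "c > 0"
      using \<open>\<eta> > 0\<close> by (auto simp: K_def c_def)
    obtain d where d: "d > 0" "\<And>y. norm (y - \<theta>) < d \<Longrightarrow> \<bar>h y - h \<theta> - D (y - \<theta>)\<bar> \<le> c * norm (y - \<theta>)"
      using der \<open>c > 0\<close> unfolding has_derivative_at_alt by (metis real_norm_def)
    have "\<forall>\<^sub>F n in sequentially. K / d < sqrt (real n)"
      by (intro filterlim_at_top_dense[THEN iffD1, rule_format]
          filterlim_compose[OF sqrt_at_top filterlim_real_sequentially])
    with tight have "\<forall>\<^sub>F n in sequentially.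
        norm ((\<integral>\<omega>. iexp (t * Y n \<omega>) \<partial>P n) - (\<integral>\<omega>. iexp (t * D (X n \<omega>)) \<partial>P n) - 0) < e"
    proof eventually_elim
      case (elim n)
      interpret prob_space "P n" by (rule prob)
      have int: "integrable (P n) (\<lambda>\<omega>. iexp (t * Y n \<omega>))" "integrable (P n) (\<lambda>\<omega>. iexp (t * D (X n \<omega>)))"
        "integrable (P n) (\<lambda>\<omega>. tail_cutoff m (X n \<omega>))"
        by (rule integrable_const_bound[of _ 1]; simp add: tail_cutoff_def)+
      have pointwise: "cmod (iexp (t * Y n \<omega>) - iexp (t * D (X n \<omega>))) \<le> \<eta> + 2 * tail_cutoff m (X n \<omega>)" for \<omega>
      proof (cases "norm (X n \<omega>) \<le> K")
        case True
        have pos: "sqrt (real n) > 0"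
          using elim \<open>K > 0\<close> \<open>d > 0\<close> by (meson divide_pos_pos less_trans)
        have "sqrt (real n) * norm (T n \<omega> - \<theta>) \<le> K"
          using True by (simp add: X_def)
        also have "K < sqrt (real n) * d"
          using elim \<open>d > 0\<close> by (simp add: field_simps)
        finally have "norm (T n \<omega> - \<theta>) < d"
          using pos by simp
        then have *: "\<bar>h (T n \<omega>) - h \<theta> - D (T n \<omega> - \<theta>)\<bar> \<le> c * norm (T n \<omega> - \<theta>)"
          by (rule d)
        have "Y n \<omega> - D (X n \<omega>) = sqrt (real n) * (h (T n \<omega>) - h \<theta> - D (T n \<omega> - \<theta>))"
          by (simp add: Y_def X_def D.scaleR right_diff_distrib)
        then have "\<bar>Y n \<omega> - D (X n \<omega>)\<bar> = sqrt (real n) * \<bar>h (T n \<omega>) - h \<theta> - D (T n \<omega> - \<theta>)\<bar>"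
          by (simp add: abs_mult)
        also have "\<dots> \<le> sqrt (real n) * (c * norm (T n \<omega> - \<theta>))"
          by (intro mult_left_mono *) simp
        also have "\<dots> = c * norm (X n \<omega>)"
          by (simp add: X_def)
        also have "\<dots> \<le> c * K"
          using True \<open>c > 0\<close> by simp
        finally have R: "\<bar>Y n \<omega> - D (X n \<omega>)\<bar> \<le> c * K" .
        have "cmod (iexp (t * Y n \<omega>) - iexp (t * D (X n \<omega>))) \<le> \<bar>t * Y n \<omega> - t * D (X n \<omega>)\<bar>"
          by (rule iexp_diff_le)
        also have "\<dots> = \<bar>t\<bar> * \<bar>Y n \<omega> - D (X n \<omega>)\<bar>"
          by (simp add: abs_mult flip: right_diff_distrib)
        also have "\<dots> \<le> (\<bar>t\<bar> + 1) * (c * K)"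
          using R by (intro mult_mono) auto
        also have "\<dots> = \<eta>"
          using \<open>K > 0\<close> add_nonneg_pos[OF abs_ge_zero zero_less_one, of t] by (simp add: c_def)
        also have "\<dots> \<le> \<eta> + 2 * tail_cutoff m (X n \<omega>)"
          by (simp add: tail_cutoff_def)
        finally show ?thesis .
      next
        case False
        then have "tail_cutoff m (X n \<omega>) = 1"
          by (simp add: tail_cutoff_def K_def)
        moreover have "cmod (iexp (t * Y n \<omega>) - iexp (t * D (X n \<omega>))) \<le> 1 + 1"
          by (rule order_trans[OF norm_triangle_ineq4]) simp
        ultimately show ?thesis
          using \<open>\<eta> > 0\<close> by simp
      qed
      have "cmod ((\<integral>\<omega>. iexp (t * Y n \<omega>) \<partial>P n) - (\<integral>\<omega>. iexp (t * D (X n \<omega>)) \<partial>P n)) =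
          cmod (\<integral>\<omega>. iexp (t * Y n \<omega>) - iexp (t * D (X n \<omega>)) \<partial>P n)"
        using int by (subst Bochner_Integration.integral_diff) auto
      also have "\<dots> \<le> (\<integral>\<omega>. cmod (iexp (t * Y n \<omega>) - iexp (t * D (X n \<omega>))) \<partial>P n)"
        by (rule integral_norm_bound)
      also have "\<dots> \<le> (\<integral>\<omega>. \<eta> + 2 * tail_cutoff m (X n \<omega>) \<partial>P n)"
        using int by (intro integral_mono pointwise integrable_norm Bochner_Integration.integrable_diff
            Bochner_Integration.integrable_add integrable_mult_right) auto
      also have "\<dots> = \<eta> + 2 * (\<integral>\<omega>. tail_cutoff m (X n \<omega>) \<partial>P n)"
        using int by (simp add: prob_space)
      also have "\<dots> < e"
        using elim by (simp add: \<eta>_def)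
      finally show ?case
        by simp
    qed
    then show "\<exists>n0. \<forall>n\<ge>n0.
        norm ((\<integral>\<omega>. iexp (t * Y n \<omega>) \<partial>P n) - (\<integral>\<omega>. iexp (t * D (X n \<omega>)) \<partial>P n) - 0) < e"
      by (simp add: eventually_sequentially)
  qed
  have "(\<lambda>n. \<integral>\<omega>. iexp (t * Y n \<omega>) \<partial>P n) \<longlonglongrightarrow> (\<integral>x. iexp (t * D x) \<partial>N)"
    using tendsto_add[OF diff lim] by simp
  then show "(\<lambda>n. char (distr (P n) borel (\<lambda>\<omega>. sqrt (real n) * (h (T n \<omega>) - h \<theta>))) t)
      \<longlonglongrightarrow> char (distr N borel D) t"
    by (simp add: char_def integral_distr Y_def)
qed

section \<open>Asymptotic normality of functions of the estimated matrix\<close>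

definition unvectorize :: "real ^ ('n \<times> 'm) \<Rightarrow> real ^ 'n ^ 'm" where
  "unvectorize v = (\<chi> i j. v $ (j, i))"

lemma unvectorize_vectorize [simp]: "unvectorize (vectorize A) = A"
  by (simp add: unvectorize_def vectorize_def vec_eq_iff)

lemma vectorize_unvectorize [simp]: "vectorize (unvectorize v) = v"
  by (simp add: unvectorize_def vectorize_def vec_eq_iff)

lemma bounded_linear_vectorize: "bounded_linear (vectorize :: real ^ 'n ^ 'm \<Rightarrow> real ^ ('n \<times> 'm))"
  by (intro linear_conv_bounded_linear[THEN iffD1] linearI) (simp_all add: vectorize_def vec_eq_iff)

lemma bounded_linear_unvectorize: "bounded_linear (unvectorize :: real ^ ('n \<times> 'm) \<Rightarrow> real ^ 'n ^ 'm)"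
  by (intro linear_conv_bounded_linear[THEN iffD1] linearI) (simp_all add: unvectorize_def vec_eq_iff)

text \<open>The delta method for \<open>g\<close> as a function of the stacked vector, standardised by its asymptotic
  standard deviation. A nonzero variance forces \<open>b \<noteq> 0\<close>, and then the limit law is that of a
  standardised nonzero linear functional of a normal vector.\<close>

lemma matrix_function_asymptotically_normal:
  fixes M :: "real ^ 'p ^ 'p" and \<Omega> :: "real ^ ('p \<times> 'p) ^ ('p \<times> 'p)"
    and P :: "nat \<Rightarrow> 'w measure" and g :: "real ^ 'p ^ 'p \<Rightarrow> real"
  assumes prob: "\<And>n. prob_space (P n)"
    and estimator: "\<And>n. Mhat n \<in> borel_measurable (P n)"
    and pos_def: "positive_definite \<Omega>"
    and clt: "converges_in_distr P
                (\<lambda>n \<omega>. sqrt (real n) *\<^sub>R vectorize (Mhat n \<omega> - M)) (multi_normal \<Omega>)"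
    and g: "g \<in> borel_measurable borel"
    and der: "(g has_derivative (\<lambda>H. b \<bullet> vectorize H)) (at M)"
    and var: "asymp_var \<Omega> b \<noteq> 0"
  shows "weak_conv_m
    (\<lambda>n. distr (P n) borel (\<lambda>\<omega>. sqrt (real n) * ((g (Mhat n \<omega>) - g M) / sqrt (asymp_var \<Omega> b))))
    std_normal_distribution"
proof -
  let ?\<sigma> = "sqrt (asymp_var \<Omega> b)"
  interpret vec: bounded_linear "vectorize :: real ^ 'p ^ 'p \<Rightarrow> real ^ ('p \<times> 'p)"
    by (rule bounded_linear_vectorize)
  have vec_measurable: "(\<lambda>\<omega>. vectorize (Mhat n \<omega>)) \<in> borel_measurable (P n)" for n
    by (rule measurable_compose[OF estimator borel_measurable_continuous_onI])
      (intro linear_continuous_on bounded_linear_vectorize)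
  have unvec_measurable: "unvectorize \<in> borel_measurable (borel :: (real ^ ('p \<times> 'p)) measure)"
    by (intro borel_measurable_continuous_onI linear_continuous_on bounded_linear_unvectorize)
  have h_measurable: "(\<lambda>v. g (unvectorize v) / ?\<sigma>) \<in> borel_measurable borel"
    using measurable_compose[OF unvec_measurable g] by simp
  have "((\<lambda>v. g (unvectorize v)) has_derivative (\<lambda>v. b \<bullet> v)) (at (vectorize M))"
    using has_derivative_compose[OF bounded_linear_imp_has_derivative[OF bounded_linear_unvectorize],
        of g "\<lambda>H. b \<bullet> vectorize H" "vectorize M"] der
    by simp
  from has_derivative_mult_left[OF this, of "inverse ?\<sigma>"]
  have h_der: "((\<lambda>v. g (unvectorize v) / ?\<sigma>) has_derivative (\<lambda>v. (b \<bullet> v) / ?\<sigma>)) (at (vectorize M))"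
    by (simp add: divide_inverse)
  have "b \<noteq> 0"
    using var by (auto simp: asymp_var_def)
  have "weak_conv_m
      (\<lambda>n. distr (P n) borel (\<lambda>\<omega>. sqrt (real n) * (g (unvectorize (vectorize (Mhat n \<omega>))) / ?\<sigma> -
        g (unvectorize (vectorize M)) / ?\<sigma>)))
      (distr (multi_normal \<Omega>) borel (\<lambda>v. (b \<bullet> v) / ?\<sigma>))"
    using clt by (intro delta_method[OF prob vec_measurable _ _ h_measurable h_der]) (simp_all add: vec.diff)
  moreover have "distr (multi_normal \<Omega>) borel (\<lambda>v. (b \<bullet> v) / ?\<sigma>) = std_normal_distribution"
    using pos_def converges_in_distr_prob_space[OF prob clt] \<open>b \<noteq> 0\<close> by (rule distr_multi_normal_inner)
  ultimately show ?thesis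
    by (simp add: diff_divide_distrib)
qed

lemma asymp_var_uminus: "asymp_var \<Omega> (- b) = asymp_var \<Omega> b"
  using scaleR_vector_matrix_assoc[of "-1" b \<Omega>] by (simp add: asymp_var_def)

section \<open>The limit theorem for the centralities\<close>

theorem theorem10:
  fixes M :: "real ^ 'p ^ 'p" and \<alpha> :: real and \<beta> :: "real ^ 'p" and S :: nat
    and \<Omega> :: "real ^ ('p \<times> 'p) ^ ('p \<times> 'p)"
    and P :: "nat \<Rightarrow> 'w measure" and Mhat :: "nat \<Rightarrow> 'w \<Rightarrow> real ^ 'p ^ 'p" and i :: 'p
  assumes prob: "\<And>n. prob_space (P n)"
    and estimator: "\<And>n. Mhat n \<in> borel_measurable (P n)"
    and damping: "0 < \<alpha>" "ereal \<alpha> * lambda_max M < 1"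
    and pos_def: "positive_definite \<Omega>"
    and clt: "converges_in_distr P
                (\<lambda>n \<omega>. sqrt (real n) *\<^sub>R vectorize (Mhat n \<omega> - M)) (multi_normal \<Omega>)"
  shows
    "(invertible (mat 1 - \<alpha> *\<^sub>R M) \<and>
      smooth_on (pagerank \<alpha> \<beta>) {A. invertible (mat 1 - \<alpha> *\<^sub>R A)} \<and>
      smooth_on (katz \<alpha>) {A :: real ^ 'p ^ 'p. invertible (mat 1 - \<alpha> *\<^sub>R A)} \<and>
      (converges_in_prob P Mhat M \<longrightarrow>
         converges_in_prob P (\<lambda>n \<omega>. pagerank \<alpha> \<beta> (Mhat n \<omega>) $ i) (pagerank \<alpha> \<beta> M $ i)) \<and>
      (asymp_var \<Omega> (B_pagerank \<alpha> \<beta> M i) \<noteq> 0 \<longrightarrow>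
         weak_conv_m
           (\<lambda>n. distr (P n) borel (\<lambda>\<omega>. sqrt (real n) *
              ((pagerank \<alpha> \<beta> (Mhat n \<omega>) $ i - pagerank \<alpha> \<beta> M $ i) /
                 sqrt (asymp_var \<Omega> (B_pagerank \<alpha> \<beta> M i)))))
           std_normal_distribution) \<and>
      (converges_in_prob P Mhat M \<longrightarrow>
         converges_in_prob P (\<lambda>n \<omega>. katz \<alpha> (Mhat n \<omega>) $ i) (katz \<alpha> M $ i)) \<and>
      weak_conv_m
        (\<lambda>n. distr (P n) borel (\<lambda>\<omega>. sqrt (real n) *
           ((katz \<alpha> (Mhat n \<omega>) $ i - katz \<alpha> M $ i) /
              sqrt (asymp_var \<Omega> (B_pagerank \<alpha> 1 M i)))))
        std_normal_distribution) \<and>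
     (smooth_on (diffusion \<alpha> S :: real ^ 'p ^ 'p \<Rightarrow> real ^ 'p) UNIV \<and>
      (converges_in_prob P Mhat M \<longrightarrow>
         converges_in_prob P (\<lambda>n \<omega>. diffusion \<alpha> S (Mhat n \<omega>) $ i) (diffusion \<alpha> S M $ i)) \<and>
      (asymp_var \<Omega> (B_diffusion \<alpha> S M i) \<noteq> 0 \<longrightarrow>
         weak_conv_m
           (\<lambda>n. distr (P n) borel (\<lambda>\<omega>. sqrt (real n) *
              ((diffusion \<alpha> S (Mhat n \<omega>) $ i - diffusion \<alpha> S M $ i) /
                 sqrt (asymp_var \<Omega> (B_diffusion \<alpha> S M i)))))
           std_normal_distribution))"
proof -
  have inv: "invertible (mat 1 - \<alpha> *\<^sub>R M)"
    using damping by (rule invertible_below_lambda_max)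
  have pagerank_prob: "converges_in_prob P (\<lambda>n \<omega>. pagerank \<alpha> b (Mhat n \<omega>) $ i) (pagerank \<alpha> b M $ i)"
    if "converges_in_prob P Mhat M" for b
    by (rule converges_in_prob_continuous[OF prob estimator that
          has_derivative_continuous[OF pagerank_has_derivative[OF inv]]])
  have pagerank_normal: "weak_conv_m
      (\<lambda>n. distr (P n) borel (\<lambda>\<omega>. sqrt (real n) *
        ((pagerank \<alpha> b (Mhat n \<omega>) $ i - pagerank \<alpha> b M $ i) /
          sqrt (asymp_var \<Omega> (B_pagerank \<alpha> b M i)))))
      std_normal_distribution" if "asymp_var \<Omega> (B_pagerank \<alpha> b M i) \<noteq> 0" for b
    using matrix_function_asymptotically_normal[OF prob estimator pos_def clt
        borel_measurable_pagerank pagerank_has_derivative[OF inv], of b i] that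
    by (simp add: asymp_var_uminus)
  have diffusion_prob: "converges_in_prob P (\<lambda>n \<omega>. diffusion \<alpha> S (Mhat n \<omega>) $ i) (diffusion \<alpha> S M $ i)"
    if "converges_in_prob P Mhat M"
    by (rule converges_in_prob_continuous[OF prob estimator that
          has_derivative_continuous[OF diffusion_has_derivative]])
  have diffusion_normal: "weak_conv_m
      (\<lambda>n. distr (P n) borel (\<lambda>\<omega>. sqrt (real n) *
        ((diffusion \<alpha> S (Mhat n \<omega>) $ i - diffusion \<alpha> S M $ i) /
          sqrt (asymp_var \<Omega> (B_diffusion \<alpha> S M i)))))
      std_normal_distribution" if "asymp_var \<Omega> (B_diffusion \<alpha> S M i) \<noteq> 0"
    by (rule matrix_function_asymptotically_normal[OF prob estimator pos_def clt
          borel_measurable_continuous_onI[OF continuous_on_diffusion] diffusion_has_derivative that])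
  have "B_pagerank \<alpha> 1 M i \<noteq> 0"
    using inv damping by (intro B_pagerank_nonzero) (auto simp: vec_eq_iff)
  then have katz_var: "asymp_var \<Omega> (B_pagerank \<alpha> 1 M i) \<noteq> 0"
    using asymp_var_pos[OF pos_def] by (simp add: less_imp_neq[symmetric])
  show ?thesis
    unfolding katz_eq_pagerank
    using inv smooth_on_pagerank smooth_on_diffusion pagerank_prob pagerank_normal katz_var
      diffusion_prob diffusion_normal
    by (intro conjI impI) blast+
qed

end
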